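(* Let $$\beta_1=\sigma_1\sigma_2^{-1}\in B_3,\qquad \beta_2=\sigma_1^{-3}\sigma_3^{-2}\sigma_5^{-3}\sigma_2\sigma_4\in B_6,\qquad \beta_3=\sigma_2^{-2}\sigma_1\sigma_3^{-1}\in B_4,$$ and let $\beta\in B_{36}$ be the horizontal juxtaposition $$\beta=(\beta_1^{36},\ \beta_2^{18},\ \beta_1^{36},\ \beta_3^{30},\ \beta_3^{30},\ \beta_3^{30},\ \beta_1^{36},\ \beta_2^{18},\ \beta_1^{36}).$$ Then the displayed expressions of these braids have a minimal number of crossings: (i) for every integer $k$, the minimal numbers of crossings of $\beta_1^k$, $\beta_2^k$ and $\beta_3^k$ (in $B_3$, $B_6$ and $B_4$, respectively) are $2|k|$, $10|k|$ and $4|k|$; (ii) the minimal number of crossings of $\beta$ in $B_{36}$ is $1008$.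
   Context: For $n\ge 1$, $B_n$ denotes the braid group on $n$ strands, with generators $\sigma_1,\dots,\sigma_{n-1}$ and defining relations $\sigma_i\sigma_{i+1}\sigma_i=\sigma_{i+1}\sigma_i\sigma_{i+1}$ for $1\le i\le n-2$, and $\sigma_i\sigma_j=\sigma_j\sigma_i$ whenever $|i-j|>1$. The number of crossings of a word in the letters $\sigma_1^{\pm1},\dots,\sigma_{n-1}^{\pm1}$ is its length (so $\sigma_1^{-3}$ counts as three crossings). The minimal number of crossings of a braid $b\in B_n$ is the least length of a word in $\sigma_1^{\pm1},\dots,\sigma_{n-1}^{\pm1}$ representing $b$ in $B_n$. Juxtaposition: given braids $b_1\in B_{n_1},\dots,b_r\in B_{n_r}$, the braid $(b_1,\dots,b_r)\in B_{n_1+\cdots+n_r}$ is obtained by placing $b_1,\dots,b_r$ next to each other from left to right. Algebraically, with $m_k=n_1+\cdots+n_{k-1}$ (so $m_1=0$), it is the product $\iota_1(b_1)\cdots\iota_r(b_r)$, where $\iota_k\colon B_{n_k}\to B_{n_1+\cdots+n_r}$ is the homomorphism $\sigma_i\mapsto\sigma_{m_k+i}$. Here $36=3+6+3+4+4+4+3+6+3$. *)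

theory Defs
  imports "HOL-Algebra.Group"
begin

section \<open>The braid group as a finitely presented group\<close>

text \<open>The pair \<open>(i, True)\<close> stands for $\sigma_i$ and \<open>(i, False)\<close> for $\sigma_i^{-1}$.\<close>

type_synonym braid_word = "(nat \<times> bool) list"

definition braid_words :: "nat \<Rightarrow> braid_word set" where
  "braid_words n = lists ({i. 1 \<le> i \<and> i < n} \<times> UNIV)"

inductive braid_eq :: "nat \<Rightarrow> braid_word \<Rightarrow> braid_word \<Rightarrow> bool" for n :: nat where
  refl: "w \<in> braid_words n \<Longrightarrow> braid_eq n w w"
| sym: "braid_eq n u v \<Longrightarrow> braid_eq n v u"
| trans: "braid_eq n u v \<Longrightarrow> braid_eq n v w \<Longrightarrow> braid_eq n u w"
| append: "braid_eq n u u' \<Longrightarrow> braid_eq n v v' \<Longrightarrow> braid_eq n (u @ v) (u' @ v')"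
| cancel: "1 \<le> i \<Longrightarrow> i < n \<Longrightarrow> braid_eq n [(i, e), (i, \<not> e)] []"
| braid: "1 \<le> i \<Longrightarrow> i + 1 < n \<Longrightarrow>
    braid_eq n [(i, True), (i + 1, True), (i, True)] [(i + 1, True), (i, True), (i + 1, True)]"
| commute: "1 \<le> i \<Longrightarrow> i < n \<Longrightarrow> 1 \<le> j \<Longrightarrow> j < n \<Longrightarrow> i + 1 < j \<or> j + 1 < i \<Longrightarrow>
    braid_eq n [(i, True), (j, True)] [(j, True), (i, True)]"

definition braid_class :: "nat \<Rightarrow> braid_word \<Rightarrow> braid_word set" where
  "braid_class n w = {(u, v). braid_eq n u v} `` {w}"

definition braid_group :: "nat \<Rightarrow> braid_word set monoid" where
  "braid_group n =
    \<lparr>carrier = braid_words n // {(u, v). braid_eq n u v},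
     mult = (\<lambda>A B. \<Union>u\<in>A. \<Union>v\<in>B. braid_class n (u @ v)),
     one = braid_class n []\<rparr>"

definition sigma :: "nat \<Rightarrow> nat \<Rightarrow> braid_word set" where
  "sigma n i = braid_class n [(i, True)]"

text \<open>A braid is the set of all words representing it.\<close>

definition min_crossings :: "braid_word set \<Rightarrow> nat" where
  "min_crossings b = (LEAST l. \<exists>w\<in>b. length w = l)"

lemma braid_words_simps [simp]:
  "[] \<in> braid_words n"
  "(i, e) # w \<in> braid_words n \<longleftrightarrow> 1 \<le> i \<and> i < n \<and> w \<in> braid_words n"
  "u @ v \<in> braid_words n \<longleftrightarrow> u \<in> braid_words n \<and> v \<in> braid_words n"
  by (auto simp: braid_words_def)

lemma braid_eq_words: "braid_eq n u v \<Longrightarrow> u \<in> braid_words n \<and> v \<in> braid_words n"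
  by (induction rule: braid_eq.induct) auto

lemma equiv_braid_eq: "equiv (braid_words n) {(u, v). braid_eq n u v}"
  by (rule equivI)
    (auto simp: refl_on_def sym_def trans_def dest: braid_eq_words intro: braid_eq.intros)

lemma mem_braid_class [simp]: "v \<in> braid_class n u \<longleftrightarrow> braid_eq n u v"
  by (simp add: braid_class_def)

lemma braid_class_eq_iff:
  "u \<in> braid_words n \<Longrightarrow> v \<in> braid_words n \<Longrightarrow>
    braid_class n u = braid_class n v \<longleftrightarrow> braid_eq n u v"
  unfolding braid_class_def using eq_equiv_class_iff[OF equiv_braid_eq, of u n v] by simp

lemma braid_class_cong: "braid_eq n u v \<Longrightarrow> braid_class n u = braid_class n v"
  using braid_class_eq_iff braid_eq_words by blast

lemma carrier_braid_group: "carrier (braid_group n) = braid_class n ` braid_words n"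
  by (auto simp: braid_group_def quotient_def braid_class_def)

lemma one_braid_group: "\<one>\<^bsub>braid_group n\<^esub> = braid_class n []"
  by (simp add: braid_group_def)

lemma mult_braid_class:
  assumes "u \<in> braid_words n" "v \<in> braid_words n"
  shows "braid_class n u \<otimes>\<^bsub>braid_group n\<^esub> braid_class n v = braid_class n (u @ v)"
proof -
  have "braid_class n (u' @ v') = braid_class n (u @ v)"
    if "braid_eq n u u'" "braid_eq n v v'" for u' v'
    using braid_class_cong[OF braid_eq.append[OF that]] by simp
  moreover have "braid_eq n u u" "braid_eq n v v"
    using assms by (auto intro: braid_eq.refl)
  ultimately have "(\<Union>u'\<in>braid_class n u. \<Union>v'\<in>braid_class n v. braid_class n (u' @ v'))
      = braid_class n (u @ v)"
    unfolding set_eq_iff UN_iff mem_braid_class[of _ n u] mem_braid_class[of _ n v] Bex_def by metis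
  then show ?thesis
    by (simp add: braid_group_def)
qed

definition inverse_word :: "braid_word \<Rightarrow> braid_word" where
  "inverse_word w = rev (map (\<lambda>(i, e). (i, \<not> e)) w)"

lemma inverse_word_in [simp]: "w \<in> braid_words n \<Longrightarrow> inverse_word w \<in> braid_words n"
  by (auto simp: inverse_word_def braid_words_def)

lemma inverse_word_cancel: "w \<in> braid_words n \<Longrightarrow> braid_eq n (inverse_word w @ w) []"
proof (induction w)
  case Nil
  then show ?case by (simp add: inverse_word_def braid_eq.refl)
next
  case (Cons a w)
  obtain i e where a: "a = (i, e)" by (cases a)
  have w: "w \<in> braid_words n" and i: "1 \<le> i" "i < n" using Cons.prems a by auto
  have "braid_eq n (inverse_word w @ ([(i, \<not> e), (i, \<not> \<not> e)] @ w)) (inverse_word w @ ([] @ w))"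
    using w i by (intro braid_eq.append braid_eq.cancel braid_eq.refl) auto
  then have "braid_eq n (inverse_word (a # w) @ (a # w)) (inverse_word w @ w)"
    by (simp add: a inverse_word_def)
  then show ?case using Cons.IH[OF w] by (rule braid_eq.trans)
qed

lemma group_braid_group: "group (braid_group n)"
proof (rule groupI)
  fix x assume "x \<in> carrier (braid_group n)"
  then obtain w where w: "w \<in> braid_words n" "x = braid_class n w"
    by (auto simp: carrier_braid_group)
  have "braid_class n (inverse_word w) \<otimes>\<^bsub>braid_group n\<^esub> x = \<one>\<^bsub>braid_group n\<^esub>"
    using w by (simp add: mult_braid_class one_braid_group braid_class_cong inverse_word_cancel)
  then show "\<exists>y\<in>carrier (braid_group n). y \<otimes>\<^bsub>braid_group n\<^esub> x = \<one>\<^bsub>braid_group n\<^esub>"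
    using w by (auto simp: carrier_braid_group)
qed (auto simp: carrier_braid_group mult_braid_class one_braid_group)

lemma inv_braid_class:
  assumes "w \<in> braid_words n"
  shows "inv\<^bsub>braid_group n\<^esub> (braid_class n w) = braid_class n (inverse_word w)"
proof -
  interpret group "braid_group n" by (rule group_braid_group)
  have "braid_class n (inverse_word w) \<otimes>\<^bsub>braid_group n\<^esub> braid_class n w = \<one>\<^bsub>braid_group n\<^esub>"
    using assms
    by (simp add: mult_braid_class one_braid_group braid_class_cong inverse_word_cancel)
  then show ?thesis
    using assms by (intro inv_equality) (auto simp: carrier_braid_group)
qed

section \<open>Juxtaposition\<close>

text \<open>The homomorphism $B_n \to B_N$, $\sigma_i \mapsto \sigma_{m+i}$, for $m + n \le N$.\<close>

definition shift_word :: "nat \<Rightarrow> braid_word \<Rightarrow> braid_word" where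
  "shift_word m w = map (\<lambda>(i, e). (m + i, e)) w"

definition shift_braid :: "nat \<Rightarrow> nat \<Rightarrow> braid_word set \<Rightarrow> braid_word set" where
  "shift_braid N m b = (\<Union>w\<in>b. braid_class N (shift_word m w))"

fun juxtapose_from :: "nat \<Rightarrow> nat \<Rightarrow> (nat \<times> braid_word set) list \<Rightarrow> braid_word set" where
  "juxtapose_from N m [] = \<one>\<^bsub>braid_group N\<^esub>"
| "juxtapose_from N m ((n, b) # bs) =
    shift_braid N m b \<otimes>\<^bsub>braid_group N\<^esub> juxtapose_from N (m + n) bs"

text \<open>The entry \<open>(n, b)\<close> of the list is a braid \<open>b\<close> on \<open>n\<close> strands.\<close>

definition juxtapose :: "(nat \<times> braid_word set) list \<Rightarrow> braid_word set" where
  "juxtapose bs = juxtapose_from (sum_list (map fst bs)) 0 bs"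

lemma shift_word_append [simp]: "shift_word m (u @ v) = shift_word m u @ shift_word m v"
  by (simp add: shift_word_def)

lemma shift_word_in:
  "w \<in> braid_words n \<Longrightarrow> m + n \<le> N \<Longrightarrow> shift_word m w \<in> braid_words N"
  by (induction w) (auto simp: shift_word_def)

lemma braid_eq_shift:
  "braid_eq n u v \<Longrightarrow> m + n \<le> N \<Longrightarrow> braid_eq N (shift_word m u) (shift_word m v)"
proof (induction rule: braid_eq.induct)
  case (refl w)
  then show ?case by (intro braid_eq.refl shift_word_in)
next
  case (cancel i e)
  then show ?case using braid_eq.cancel[of "m + i" N e] by (simp add: shift_word_def)
next
  case (braid i)
  then show ?case using braid_eq.braid[of "m + i" N] by (simp add: shift_word_def)
next
  case (commute i j)
  then show ?case using braid_eq.commute[of "m + i" N "m + j"] by (auto simp: shift_word_def)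
qed (auto intro: braid_eq.intros)

lemma shift_braid_class:
  assumes "w \<in> braid_words n" "m + n \<le> N"
  shows "shift_braid N m (braid_class n w) = braid_class N (shift_word m w)"
proof -
  have "braid_class N (shift_word m v) = braid_class N (shift_word m w)"
    if "braid_eq n w v" for v
    using braid_class_cong[OF braid_eq_shift[OF that assms(2)]] by simp
  moreover have "braid_eq n w w" using assms by (auto intro: braid_eq.refl)
  ultimately show ?thesis
    unfolding shift_braid_def set_eq_iff UN_iff mem_braid_class[of _ n w] Bex_def by metis
qed

lemma shift_braid_hom:
  "m + n \<le> N \<Longrightarrow> shift_braid N m \<in> hom (braid_group n) (braid_group N)"
  by (rule homI)
    (auto simp: carrier_braid_group shift_braid_class mult_braid_class shift_word_in)

lemma shift_braid_sigma:
  "1 \<le> i \<Longrightarrow> i < n \<Longrightarrow> m + n \<le> N \<Longrightarrow> shift_braid N m (sigma n i) = sigma N (m + i)"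
  unfolding sigma_def by (subst shift_braid_class[where n = n]) (auto simp: shift_word_def)

section \<open>The braids\<close>

definition beta1 :: "braid_word set" where
  "beta1 = sigma 3 1 \<otimes>\<^bsub>braid_group 3\<^esub> inv\<^bsub>braid_group 3\<^esub> (sigma 3 2)"

definition beta2 :: "braid_word set" where
  "beta2 = sigma 6 1 [^]\<^bsub>braid_group 6\<^esub> (-3 :: int)
    \<otimes>\<^bsub>braid_group 6\<^esub> sigma 6 3 [^]\<^bsub>braid_group 6\<^esub> (-2 :: int)
    \<otimes>\<^bsub>braid_group 6\<^esub> sigma 6 5 [^]\<^bsub>braid_group 6\<^esub> (-3 :: int)
    \<otimes>\<^bsub>braid_group 6\<^esub> sigma 6 2 \<otimes>\<^bsub>braid_group 6\<^esub> sigma 6 4"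

definition beta3 :: "braid_word set" where
  "beta3 = sigma 4 2 [^]\<^bsub>braid_group 4\<^esub> (-2 :: int)
    \<otimes>\<^bsub>braid_group 4\<^esub> sigma 4 1 \<otimes>\<^bsub>braid_group 4\<^esub> inv\<^bsub>braid_group 4\<^esub> (sigma 4 3)"

definition beta :: "braid_word set" where
  "beta = juxtapose
    [(3, beta1 [^]\<^bsub>braid_group 3\<^esub> (36 :: int)),
     (6, beta2 [^]\<^bsub>braid_group 6\<^esub> (18 :: int)),
     (3, beta1 [^]\<^bsub>braid_group 3\<^esub> (36 :: int)),
     (4, beta3 [^]\<^bsub>braid_group 4\<^esub> (30 :: int)),
     (4, beta3 [^]\<^bsub>braid_group 4\<^esub> (30 :: int)),
     (4, beta3 [^]\<^bsub>braid_group 4\<^esub> (30 :: int)),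
     (3, beta1 [^]\<^bsub>braid_group 3\<^esub> (36 :: int)),
     (6, beta2 [^]\<^bsub>braid_group 6\<^esub> (18 :: int)),
     (3, beta1 [^]\<^bsub>braid_group 3\<^esub> (36 :: int))]"

lemma sigma_closed: "1 \<le> i \<Longrightarrow> i < n \<Longrightarrow> sigma n i \<in> carrier (braid_group n)"
  by (simp add: sigma_def carrier_braid_group)

lemma beta123_closed:
  "beta1 \<in> carrier (braid_group 3)"
  "beta2 \<in> carrier (braid_group 6)"
  "beta3 \<in> carrier (braid_group 4)"
proof -
  interpret B3: group "braid_group 3" by (rule group_braid_group)
  interpret B6: group "braid_group 6" by (rule group_braid_group)
  interpret B4: group "braid_group 4" by (rule group_braid_group)
  show "beta1 \<in> carrier (braid_group 3)" "beta2 \<in> carrier (braid_group 6)"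
    "beta3 \<in> carrier (braid_group 4)"
    by (simp_all add: beta1_def beta2_def beta3_def sigma_closed)
qed

lemma juxtapose_from_closed:
  assumes "\<forall>(n, b) \<in> set bs. b \<in> carrier (braid_group n)" "m + sum_list (map fst bs) \<le> N"
  shows "juxtapose_from N m bs \<in> carrier (braid_group N)"
  using assms
proof (induction bs arbitrary: m)
  case Nil
  then show ?case by (auto simp: one_braid_group carrier_braid_group)
next
  case (Cons a bs)
  obtain n b where a: "a = (n, b)" by (cases a)
  interpret group "braid_group N" by (rule group_braid_group)
  have "shift_braid N m b \<in> carrier (braid_group N)"
    using Cons.prems a by (intro hom_in_carrier[OF shift_braid_hom[of m n N]]) auto
  moreover have "juxtapose_from N (m + n) bs \<in> carrier (braid_group N)"
    using Cons.prems a by (intro Cons.IH) (auto simp: add.assoc)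
  ultimately show ?case by (simp add: a)
qed

lemma beta_closed: "beta \<in> carrier (braid_group 36)"
proof -
  interpret B3: group "braid_group 3" by (rule group_braid_group)
  interpret B6: group "braid_group 6" by (rule group_braid_group)
  interpret B4: group "braid_group 4" by (rule group_braid_group)
  have "beta = juxtapose_from 36 0
    [(3, beta1 [^]\<^bsub>braid_group 3\<^esub> (36 :: int)), (6, beta2 [^]\<^bsub>braid_group 6\<^esub> (18 :: int)),
     (3, beta1 [^]\<^bsub>braid_group 3\<^esub> (36 :: int)), (4, beta3 [^]\<^bsub>braid_group 4\<^esub> (30 :: int)),
     (4, beta3 [^]\<^bsub>braid_group 4\<^esub> (30 :: int)), (4, beta3 [^]\<^bsub>braid_group 4\<^esub> (30 :: int)),
     (3, beta1 [^]\<^bsub>braid_group 3\<^esub> (36 :: int)), (6, beta2 [^]\<^bsub>braid_group 6\<^esub> (18 :: int)),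
     (3, beta1 [^]\<^bsub>braid_group 3\<^esub> (36 :: int))]"
    by (simp add: beta_def juxtapose_def)
  also have "\<dots> \<in> carrier (braid_group 36)"
    by (rule juxtapose_from_closed) (simp_all add: beta123_closed)
  finally show ?thesis .
qed

end

theory Submission
  imports Defs "HOL-Library.Fun_Lexorder" Complex_Main
begin

text \<open>
  Call a word homogeneous if no generator occurs in it with both signs. Every homogeneous word has
  the least length among all words for the same braid; all the words of the theorem are homogeneous,
  and powers and juxtaposition preserve this property.

  A word with $p$ positive and $q$ negative letters has length $2p - (p - q)$, and the exponent sum
  $p - q$ depends only on the braid. So it suffices that a homogeneous word has the least possible
  $p$. This is detected by the action of the braid group on the exterior algebra of the Burau
  module, which has one basis vector for each set of occupied strands. The matrix of $\sigma_i$ has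
  entries of degree at most 1 in the parameter $t$, and that of $\sigma_i^{-1}$ has entries of
  degree at most 0, hence no matrix entry of a word exceeds degree $p$
  (\<open>abs_word_action_le\<close>). For a homogeneous word this degree is attained: as $t \to \infty$, the
  leading parts of all letters move particles in the same direction, so that they are triangular for
  the lexicographic order on the basis. In the diagonal entry at the set $P$ of the positive
  generators each letter contributes $1$ or $-1$, so the coefficient of $t^p$ there is
  not zero (\<open>homogeneous_leading_coefficient\<close>).

  The exterior algebra takes the place of the determinant in the classical argument, where the
  degree of the Alexander polynomial of the closed braid bounds the number of crossings. It is
  insensitive to the closed braid being split, so that juxtapositions need no separate treatment.
\<close>

section \<open>The exterior algebra of the Burau module\<close>

text \<open>A state tells which strands are occupied.\<close>

type_synonym state = "nat \<Rightarrow> bool"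

definition exchange :: "nat \<Rightarrow> state \<Rightarrow> state" where
  "exchange i s = s(i := s (Suc i), Suc i := s i)"

text \<open>On one particle this is the Burau matrix with rows $(1 - t, t)$ and $(1, 0)$, and on two
  adjacent particles its determinant $-t$. Functions on all states are acted on, so the same
  formula serves every number of strands.\<close>

fun letter_action :: "real \<Rightarrow> nat \<times> bool \<Rightarrow> (state \<Rightarrow> real) \<Rightarrow> state \<Rightarrow> real" where
  "letter_action t (i, True) f s =
    (if s i then if s (Suc i) then - t * f s else (1 - t) * f s + t * f (exchange i s)
     else if s (Suc i) then f (exchange i s) else f s)"
| "letter_action t (i, False) f s =
    (if s i then if s (Suc i) then - f s / t else f (exchange i s)
     else if s (Suc i) then f (exchange i s) / t + (1 - 1 / t) * f s else f s)"

definition word_action :: "real \<Rightarrow> braid_word \<Rightarrow> (state \<Rightarrow> real) \<Rightarrow> state \<Rightarrow> real" where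
  "word_action t w = foldr (letter_action t) w"

lemma word_action_simps [simp]:
  "word_action t [] f = f"
  "word_action t (a # w) f = letter_action t a (word_action t w f)"
  "word_action t (u @ v) f = word_action t u (word_action t v f)"
  by (simp_all add: word_action_def)

lemma exchange_apply:
  "exchange i s i = s (Suc i)" "exchange i s (Suc i) = s i"
  "j \<noteq> i \<Longrightarrow> j \<noteq> Suc i \<Longrightarrow> exchange i s j = s j"
  by (simp_all add: exchange_def)

lemma exchange_exchange [simp]: "exchange i (exchange i s) = s"
  by (auto simp: exchange_def fun_eq_iff)

lemma exchange_braid:
  "exchange i (exchange (Suc i) (exchange i s)) = exchange (Suc i) (exchange i (exchange (Suc i) s))"
  by (auto simp: exchange_def fun_eq_iff)

lemma exchange_trivial: "s i = s (Suc i) \<Longrightarrow> exchange i s = s"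
  by (auto simp: exchange_def fun_eq_iff)

lemma exchange_commute:
  "Suc i < j \<or> Suc j < i \<Longrightarrow> exchange i (exchange j s) = exchange j (exchange i s)"
  by (auto simp: exchange_def fun_eq_iff)

lemma letter_action_cancel:
  assumes "t \<noteq> 0"
  shows "letter_action t (i, e) (letter_action t (i, \<not> e) f) = f"
proof
  fix s
  show "letter_action t (i, e) (letter_action t (i, \<not> e) f) s = f s"
    using assms
    by (cases e; cases "s i"; cases "s (Suc i)") (simp_all add: exchange_apply field_simps)
qed

lemma letter_action_commute:
  assumes "Suc i < j \<or> Suc j < i"
  shows "letter_action t (i, True) (letter_action t (j, True) f)
    = letter_action t (j, True) (letter_action t (i, True) f)"
proof
  fix s
  have "j \<noteq> i" "j \<noteq> Suc i" "Suc j \<noteq> i" using assms by auto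
  then show "letter_action t (i, True) (letter_action t (j, True) f) s
    = letter_action t (j, True) (letter_action t (i, True) f) s"
    using exchange_commute[OF assms, of s]
    by (cases "s i"; cases "s (Suc i)"; cases "s j"; cases "s (Suc j)")
      (simp_all add: exchange_apply algebra_simps)
qed

lemma letter_action_braid:
  "letter_action t (i, True) (letter_action t (Suc i, True) (letter_action t (i, True) f))
    = letter_action t (Suc i, True) (letter_action t (i, True) (letter_action t (Suc i, True) f))"
proof
  fix s
  show "letter_action t (i, True) (letter_action t (Suc i, True) (letter_action t (i, True) f)) s
    = letter_action t (Suc i, True) (letter_action t (i, True) (letter_action t (Suc i, True) f)) s"
    using exchange_braid[of i s] exchange_trivial[of s i] exchange_trivial[of s "Suc i"]
      exchange_trivial[of "exchange i s" "Suc i"] exchange_trivial[of "exchange (Suc i) s" i]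
    by (cases "s i"; cases "s (Suc i)"; cases "s (Suc (Suc i))")
      (simp_all add: exchange_apply algebra_simps)
qed

lemma word_action_braid_eq:
  assumes "braid_eq n u v" "t \<noteq> 0"
  shows "word_action t u f = word_action t v f"
  using assms
proof (induction arbitrary: f rule: braid_eq.induct)
  case (cancel i e)
  then show ?case using letter_action_cancel by simp
next
  case (braid i)
  then show ?case using letter_action_braid by simp
next
  case (commute i j)
  then show ?case using letter_action_commute[of i j] by simp
qed auto

section \<open>Degrees in the Burau parameter\<close>

definition positives :: "braid_word \<Rightarrow> nat" where
  "positives w = length (filter snd w)"

lemma positives_simps [simp]:
  "positives [] = 0"
  "positives ((i, e) # w) = of_bool e + positives w"
  "positives (u @ v) = positives u + positives v"
  by (simp_all add: positives_def)

text \<open>The exponent sum, positive minus negative letters, is the same on both sides of every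
  relation; it is written so that the length of a word can be read off.\<close>

lemma exponent_sum_braid_eq:
  "braid_eq n u v \<Longrightarrow>
    2 * int (positives u) - int (length u) = 2 * int (positives v) - int (length v)"
  by (induction rule: braid_eq.induct) auto

text \<open>The absolute values in each row of a letter's matrix add up to at most $2t$ for a positive
  and at most 2 for a negative letter.\<close>

lemma abs_word_action_le:
  assumes "1 \<le> t" "\<And>s. \<bar>f s\<bar> \<le> 1"
  shows "\<bar>word_action t w f s\<bar> \<le> 2 ^ length w * t ^ positives w"
proof (induction w arbitrary: s)
  case Nil
  then show ?case using assms by simp
next
  case (Cons a w)
  define C where "C = 2 ^ length w * t ^ positives w"
  define g where "g = word_action t w f"
  have g: "\<bar>g s\<bar> \<le> C" for s using Cons.IH by (simp add: g_def C_def)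
  have C: "0 \<le> C" using assms by (simp add: C_def)
  obtain i e where a: "a = (i, e)" by (cases a)
  have combine: "\<bar>x * g u + y * g v\<bar> \<le> z * C" if "\<bar>x\<bar> + \<bar>y\<bar> \<le> z" for x y z u v
  proof -
    have "\<bar>x * g u + y * g v\<bar> \<le> \<bar>x\<bar> * \<bar>g u\<bar> + \<bar>y\<bar> * \<bar>g v\<bar>"
      by (metis abs_mult abs_triangle_ineq)
    also have "\<dots> \<le> \<bar>x\<bar> * C + \<bar>y\<bar> * C"
      using g by (intro add_mono mult_left_mono) auto
    also have "\<dots> \<le> z * C" using that C by (metis distrib_right mult_right_mono)
    finally show ?thesis .
  qed
  have t: "1 / t \<le> 2" using assms(1) by (simp add: divide_le_eq)
  have "\<bar>letter_action t (i, True) g s\<bar> \<le> (2 * t) * C"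
    using combine[of "- t" 0 "2 * t" s s] combine[of "1 - t" t "2 * t" s "exchange i s"]
      combine[of 1 0 "2 * t" "exchange i s" s] combine[of 1 0 "2 * t" s s] assms(1)
    by auto
  moreover have "\<bar>letter_action t (i, False) g s\<bar> \<le> 2 * C"
    using combine[of "- (1 / t)" 0 2 s s] combine[of 1 0 2 "exchange i s" s]
      combine[of "1 / t" "1 - 1 / t" 2 "exchange i s" s] combine[of 1 0 2 s s] assms(1) t
    by auto
  ultimately show ?case by (cases e) (simp_all add: a C_def g_def mult.assoc mult.left_commute)
qed

text \<open>The limits of \<open>letter_action t (i, True) / t\<close> and of \<open>letter_action t (i, False)\<close> as
  $t \to \infty$. Both depend on values at \<open>exchange i s\<close> only when \<open>s i\<close> holds and
  \<open>s (Suc i)\<close> does not; this makes them triangular.\<close>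

fun leading_action :: "nat \<times> bool \<Rightarrow> (state \<Rightarrow> real) \<Rightarrow> state \<Rightarrow> real" where
  "leading_action (i, True) f s =
    (if s i then if s (Suc i) then - f s else f (exchange i s) - f s else 0)"
| "leading_action (i, False) f s =
    (if s i then if s (Suc i) then 0 else f (exchange i s) else f s)"

lemma tendsto_letter_action:
  assumes "\<And>s. ((\<lambda>t. g t s / t ^ p) \<longlongrightarrow> f s) at_top"
  shows "((\<lambda>t. letter_action t (i, e) (g t) s / t ^ (of_bool e + p))
    \<longlongrightarrow> leading_action (i, e) f s) at_top"
proof -
  define h where "h t s = g t s / t ^ p" for t s
  have h [tendsto_intros]: "((\<lambda>t. h t s) \<longlongrightarrow> f s) at_top" for s
    using assms by (simp add: h_def)
  define u :: "real \<Rightarrow> real" where "u t = 1 / t" for t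
  have [tendsto_intros]: "(u \<longlongrightarrow> 0) at_top"
    unfolding u_def
    by (intro tendsto_divide_0[OF tendsto_const] filterlim_at_top_imp_at_infinity filterlim_ident)
  define k where "k t = (if e
    then if s i then if s (Suc i) then - h t s else (u t - 1) * h t s + h t (exchange i s)
      else u t * h t (if s (Suc i) then exchange i s else s)
    else if s i then if s (Suc i) then - (u t * h t s) else h t (exchange i s)
      else if s (Suc i) then u t * h t (exchange i s) + (1 - u t) * h t s else h t s)" for t
  have "((\<lambda>t. k t) \<longlongrightarrow> leading_action (i, e) f s) at_top"
    unfolding k_def
    by (cases e; cases "s i"; cases "s (Suc i)") (auto intro!: tendsto_eq_intros)
  moreover have "\<forall>\<^sub>F t in at_top. k t = letter_action t (i, e) (g t) s / t ^ (of_bool e + p)"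
    using eventually_gt_at_top[of 0]
    by eventually_elim
      (cases e; cases "s i"; cases "s (Suc i)"; simp add: k_def h_def u_def field_simps)
  ultimately show ?thesis by (rule Lim_transform_eventually)
qed

lemma less_fun_exchange: "s i \<Longrightarrow> \<not> s (Suc i) \<Longrightarrow> less_fun (exchange i s) s"
  by (auto simp: exchange_def intro!: less_funI)

text \<open>The leading coefficients $L$ of the column of the matrix at \<open>P\<close> are supported on states
  that are not below \<open>P\<close>. Hence applying another letter changes the value at \<open>P\<close> only through
  the diagonal entry, which is $-1$ for a positive letter, as \<open>P i\<close> holds, and $1$ for a negative
  letter, as \<open>P i\<close> fails.\<close>

lemma homogeneous_leading_coefficient:
  assumes "\<forall>(i, e) \<in> set w. e = P i"
  defines "\<delta> \<equiv> \<lambda>s. of_bool (s = P) :: real"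
  shows "\<exists>L. (\<forall>s. ((\<lambda>t. word_action t w \<delta> s / t ^ positives w) \<longlongrightarrow> L s) at_top)
    \<and> (\<forall>s. L s \<noteq> 0 \<longrightarrow> s = P \<or> less_fun P s) \<and> L P \<noteq> 0"
  using assms(1)
proof (induction w)
  case Nil
  then show ?case by (intro exI[of _ \<delta>]) (auto simp: \<delta>_def)
next
  case (Cons a w)
  obtain i e where a: "a = (i, e)" by (cases a)
  have e: "e = P i" using Cons.prems a by auto
  obtain L where L: "\<And>s. ((\<lambda>t. word_action t w \<delta> s / t ^ positives w) \<longlongrightarrow> L s) at_top"
    and supp: "\<And>s. L s \<noteq> 0 \<Longrightarrow> s = P \<or> less_fun P s" and P: "L P \<noteq> 0"
    using Cons by auto
  have "((\<lambda>t. word_action t (a # w) \<delta> s / t ^ positives (a # w))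
      \<longlongrightarrow> leading_action (i, e) L s) at_top" for s
    using tendsto_letter_action[OF L, where i = i and e = e and s = s] by (simp add: a)
  moreover have "s = P \<or> less_fun P s" if "leading_action (i, e) L s \<noteq> 0" for s
  proof -
    have "L s \<noteq> 0 \<or> s i \<and> \<not> s (Suc i) \<and> L (exchange i s) \<noteq> 0"
      using that by (cases e) (auto split: if_splits)
    then show ?thesis using supp less_fun_exchange[where s = s and i = i] less_fun_trans by blast
  qed
  moreover have "leading_action (i, e) L P \<noteq> 0"
  proof -
    have "L (exchange i P) = 0" if "P i" "\<not> P (Suc i)"
      using supp less_fun_exchange[OF that] less_fun_irrefl less_fun_asym by metis
    then show ?thesis using P e by (cases e) auto
  qed
  ultimately show ?case by blast
qed

section \<open>Minimality of homogeneous words\<close>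

definition homogeneous :: "braid_word \<Rightarrow> bool" where
  "homogeneous w \<longleftrightarrow> (\<forall>i. (i, True) \<notin> set w \<or> (i, False) \<notin> set w)"

text \<open>With fewer positive letters, a word \<open>v\<close> for the same braid could not produce the term of
  degree \<open>positives w\<close> in $t$ that the diagonal entry of \<open>w\<close> has.\<close>

lemma homogeneous_positives_le:
  assumes "homogeneous w" "braid_eq n w v"
  shows "positives w \<le> positives v"
proof (rule ccontr)
  assume "\<not> positives w \<le> positives v"
  then obtain d where d: "positives w = Suc (d + positives v)"
    by (metis add.commute add_Suc_right less_imp_Suc_add linorder_not_le)
  define P where "P i = ((i, True) \<in> set w)" for i
  define \<delta> :: "state \<Rightarrow> real" where "\<delta> s = of_bool (s = P)" for s
  have "\<forall>(i, e) \<in> set w. e = P i"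
    using assms(1) by (auto simp: P_def homogeneous_def split: bool.splits) (metis (full_types))+
  then obtain c where c: "c \<noteq> 0"
    and lim: "((\<lambda>t. word_action t w \<delta> P / t ^ positives w) \<longlongrightarrow> c) at_top"
    using homogeneous_leading_coefficient[of w P] unfolding \<delta>_def by blast
  have bound: "\<bar>word_action t w \<delta> P / t ^ positives w\<bar> \<le> 2 ^ length v / t" if "1 \<le> t" for t
  proof -
    have "\<bar>word_action t w \<delta> P\<bar> \<le> 2 ^ length v * t ^ positives v"
      using abs_word_action_le[OF that, of \<delta> v P] word_action_braid_eq[OF assms(2), of t \<delta>] that
      by (simp add: \<delta>_def)
    also have "\<dots> \<le> 2 ^ length v * t ^ (d + positives v)"
      using that by (intro mult_left_mono power_increasing) auto
    finally show ?thesis using that by (simp add: d field_simps)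
  qed
  have "\<forall>\<^sub>F t in at_top. norm (word_action t w \<delta> P / t ^ positives w) \<le> norm (2 ^ length v / t) * 1"
    using eventually_ge_at_top[of 1]
  proof eventually_elim
    case (elim t)
    then show ?case using bound[of t] by simp
  qed
  moreover have "((\<lambda>t::real. 2 ^ length v / t) \<longlongrightarrow> 0) at_top"
    by (intro tendsto_divide_0[OF tendsto_const] filterlim_at_top_imp_at_infinity filterlim_ident)
  ultimately have "((\<lambda>t. word_action t w \<delta> P / t ^ positives w) \<longlongrightarrow> 0) at_top"
    by (rule tendsto_0_le[rotated])
  then show False using lim c tendsto_unique trivial_limit_at_top_linorder by metis
qed

lemma min_crossings_homogeneous:
  assumes "homogeneous w" "w \<in> braid_words n"
  shows "min_crossings (braid_class n w) = length w"
  unfolding min_crossings_def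
proof (rule Least_equality)
  show "\<exists>v\<in>braid_class n w. length v = length w"
    using braid_eq.refl[OF assms(2)] by (intro bexI[of _ w]) simp_all
next
  fix l assume "\<exists>v\<in>braid_class n w. length v = l"
  then obtain v where v: "braid_eq n w v" "length v = l" by auto
  show "length w \<le> l"
    using homogeneous_positives_le[OF assms(1) v(1)] exponent_sum_braid_eq[OF v(1)] v(2)
    by linarith
qed

section \<open>Powers and juxtapositions of words\<close>

definition power_word :: "braid_word \<Rightarrow> int \<Rightarrow> braid_word" where
  "power_word w k = concat (replicate (nat \<bar>k\<bar>) (if 0 \<le> k then w else inverse_word w))"

lemma concat_replicate_in [simp]: "w \<in> braid_words n \<Longrightarrow> concat (replicate k w) \<in> braid_words n"
  by (induction k) auto

lemma power_word_in [simp]: "w \<in> braid_words n \<Longrightarrow> power_word w k \<in> braid_words n"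
  by (simp add: power_word_def)

lemma length_power_word [simp]: "length (power_word w k) = nat \<bar>k\<bar> * length w"
  by (simp add: power_word_def inverse_word_def length_concat sum_list_replicate)

lemma homogeneous_power_word [simp]:
  assumes "homogeneous w"
  shows "homogeneous (power_word w k)"
proof -
  have "homogeneous (inverse_word w)"
    using assms by (auto simp: homogeneous_def inverse_word_def)
  then show ?thesis
    using assms by (auto simp: homogeneous_def power_word_def)
qed

lemma nat_pow_braid_class:
  assumes "w \<in> braid_words n"
  shows "braid_class n w [^]\<^bsub>braid_group n\<^esub> (k :: nat) = braid_class n (concat (replicate k w))"
proof (induction k)
  case 0
  then show ?case by (simp add: one_braid_group)
next
  case (Suc k)
  have "concat (replicate k w) @ w = w @ concat (replicate k w)" by (induction k) auto
  then show ?case using Suc assms by (simp add: mult_braid_class)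
qed

lemma int_pow_braid_class:
  assumes "w \<in> braid_words n"
  shows "braid_class n w [^]\<^bsub>braid_group n\<^esub> (k :: int) = braid_class n (power_word w k)"
proof (cases "0 \<le> k")
  case True
  interpret group "braid_group n" by (rule group_braid_group)
  obtain m where "k = int m" using True nonneg_int_cases by blast
  then show ?thesis using assms by (simp add: int_pow_int nat_pow_braid_class power_word_def)
next
  case False
  interpret group "braid_group n" by (rule group_braid_group)
  obtain m where m: "k = - int m" using False by (metis linear nonpos_int_cases)
  have "braid_class n w [^]\<^bsub>braid_group n\<^esub> k
      = (inv\<^bsub>braid_group n\<^esub> (braid_class n w)) [^]\<^bsub>braid_group n\<^esub> m"
    using assms by (simp add: m int_pow_neg_int nat_pow_inv carrier_braid_group)
  also have "\<dots> = braid_class n (power_word w k)"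
    using assms False by (simp add: m inv_braid_class nat_pow_braid_class power_word_def)
  finally show ?thesis .
qed

fun juxtapose_words :: "nat \<Rightarrow> (nat \<times> braid_word) list \<Rightarrow> braid_word" where
  "juxtapose_words m [] = []"
| "juxtapose_words m ((n, w) # ws) = shift_word m w @ juxtapose_words (m + n) ws"

lemma juxtapose_words_in:
  assumes "\<forall>(n, w) \<in> set ws. w \<in> braid_words n" "m + sum_list (map fst ws) \<le> N"
  shows "juxtapose_words m ws \<in> braid_words N"
  using assms by (induction m ws rule: juxtapose_words.induct) (auto intro: shift_word_in)

lemma juxtapose_from_braid_class:
  assumes "\<forall>(n, w) \<in> set ws. w \<in> braid_words n" "m + sum_list (map fst ws) \<le> N"
  shows "juxtapose_from N m (map (\<lambda>(n, w). (n, braid_class n w)) ws)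
    = braid_class N (juxtapose_words m ws)"
  using assms
proof (induction m ws rule: juxtapose_words.induct)
  case (1 m)
  then show ?case by (simp add: one_braid_group)
next
  case (2 m n w ws)
  then have "shift_word m w \<in> braid_words N" "juxtapose_words (m + n) ws \<in> braid_words N"
    by (auto intro!: shift_word_in juxtapose_words_in)
  then show ?case using 2 by (simp add: shift_braid_class mult_braid_class)
qed

lemma length_juxtapose_words: "length (juxtapose_words m ws) = (\<Sum>(n, w)\<leftarrow>ws. length w)"
  by (induction m ws rule: juxtapose_words.induct) (auto simp: shift_word_def)

lemma juxtapose_words_above:
  "\<forall>(n, w) \<in> set ws. w \<in> braid_words n \<Longrightarrow> (i, e) \<in> set (juxtapose_words m ws) \<Longrightarrow> m < i"
  by (induction m ws rule: juxtapose_words.induct)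
    (fastforce simp: shift_word_def braid_words_def)+

text \<open>Different blocks use disjoint sets of generators.\<close>

lemma homogeneous_juxtapose_words:
  assumes "\<forall>(n, w) \<in> set ws. w \<in> braid_words n \<and> homogeneous w"
  shows "homogeneous (juxtapose_words m ws)"
  using assms
proof (induction m ws rule: juxtapose_words.induct)
  case (1 m)
  then show ?case by (simp add: homogeneous_def)
next
  case (2 m n w ws)
  have "homogeneous (shift_word m w)"
    using 2 by (auto simp: homogeneous_def shift_word_def)
  moreover have "i < m + n" if "(i, e) \<in> set (shift_word m w)" for i e
    using that 2 by (auto simp: shift_word_def braid_words_def)
  moreover have "m + n < i" if "(i, e) \<in> set (juxtapose_words (m + n) ws)" for i e
    using that 2 by (intro juxtapose_words_above[of ws i e]) auto
  ultimately show ?case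
    using 2 unfolding homogeneous_def by (fastforce dest: less_asym)
qed

section \<open>The braids of the theorem\<close>

definition word1 :: braid_word where
  "word1 = [(1, True), (2, False)]"

definition word2 :: braid_word where
  "word2 = [(1, False), (1, False), (1, False), (3, False), (3, False),
    (5, False), (5, False), (5, False), (2, True), (4, True)]"

definition word3 :: braid_word where
  "word3 = [(2, False), (2, False), (1, True), (3, False)]"

lemma words_in [simp]:
  "word1 \<in> braid_words 3" "word2 \<in> braid_words 6" "word3 \<in> braid_words 4"
  by (simp_all add: word1_def word2_def word3_def)

lemma words_homogeneous [simp]: "homogeneous word1" "homogeneous word2" "homogeneous word3"
  by (auto simp: homogeneous_def word1_def word2_def word3_def)

lemma length_words [simp]: "length word1 = 2" "length word2 = 10" "length word3 = 4"
  by (simp_all add: word1_def word2_def word3_def)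

lemma beta_words:
  "beta1 = braid_class 3 word1" "beta2 = braid_class 6 word2" "beta3 = braid_class 4 word3"
  by (simp_all add: beta1_def beta2_def beta3_def sigma_def word1_def word2_def word3_def
      inv_braid_class int_pow_braid_class mult_braid_class power_word_def inverse_word_def
      numeral_eq_Suc)

theorem mainTheorem2:
  "(\<forall>k::int.
      int (min_crossings (beta1 [^]\<^bsub>braid_group 3\<^esub> k)) = 2 * \<bar>k\<bar> \<and>
      int (min_crossings (beta2 [^]\<^bsub>braid_group 6\<^esub> k)) = 10 * \<bar>k\<bar> \<and>
      int (min_crossings (beta3 [^]\<^bsub>braid_group 4\<^esub> k)) = 4 * \<bar>k\<bar>) \<and>
   min_crossings beta = 1008"
proof -
  define ws where "ws = [(3, power_word word1 36), (6, power_word word2 18),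
    (3, power_word word1 36), (4, power_word word3 30), (4, power_word word3 30),
    (4, power_word word3 30), (3, power_word word1 36), (6, power_word word2 18),
    (3::nat, power_word word1 36)]"
  have words: "\<forall>(n, w) \<in> set ws. w \<in> braid_words n" by (simp add: ws_def)
  have "beta = juxtapose_from 36 0 (map (\<lambda>(n, w). (n, braid_class n w)) ws)"
    by (simp add: beta_def juxtapose_def ws_def beta_words int_pow_braid_class)
  also have "\<dots> = braid_class 36 (juxtapose_words 0 ws)"
    using words by (rule juxtapose_from_braid_class) (simp add: ws_def)
  finally have "min_crossings beta = length (juxtapose_words 0 ws)"
    using min_crossings_homogeneous[OF homogeneous_juxtapose_words juxtapose_words_in, of ws 0 36]
    by (simp del: juxtapose_words.simps add: ws_def)
  also have "\<dots> = 1008"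
    unfolding length_juxtapose_words by (simp add: ws_def)
  finally have "min_crossings beta = 1008" .
  then show ?thesis
    by (simp add: beta_words int_pow_braid_class min_crossings_homogeneous)
qed

end
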